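(* Let $r\ge 2$, let $\omega^{(1)},\dots,\omega^{(r)}$ be a perfect system of nonnegative weights on the unit circle $\mathbb T$, and let $\vec n=(n_1,\dots,n_r)\in\mathbb N^r$ be a multi-index with $n=|\vec n|=n_1+\dots+n_r\ge 1$. Let $\mathcal K(z,\xi)$ be the Christoffel–Darboux kernel of the multiple orthogonal system for $\vec n$ and $\mathcal K_0(z,\xi)$ that of the orthogonal polynomials for $\omega^{(1)}$. Then $$\mathcal K(z,\xi)-\mathcal K_0(z,\xi)=\overline{\boldsymbol\pi(\xi)}^\top\boldsymbol{\mathcal M}_{22}^{-1}\boldsymbol\varphi_2(z),$$ where $$\boldsymbol\pi(\xi)=\boldsymbol\psi_2(\xi)-\int_{\mathbb T}\overline{\mathcal K_0(s,\xi)}\,\boldsymbol\psi_2(s)\,\frac{|ds|}{2\pi}.$$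
   Context: Weights: each $\omega^{(j)}$ is a nonnegative function on $\mathbb T=\{|z|=1\}$ such that the measure $\omega^{(j)}(z)\frac{|dz|}{2\pi}$ ($\frac{|dz|}{2\pi}$ is normalized arclength) is a positive measure with all moments existing. $\mathbb N=\{0,1,2,\dots\}$; empty blocks contribute $0$ to sums. Here $z\in\mathbb C$, $\xi\in\mathbb T$. For a multi-index $\vec m=(m_1,\dots,m_r)$: the type II polynomial $\Phi_{\vec m}$ is a monic polynomial of degree $|\vec m|$ with $\int_{\mathbb T}\Phi_{\vec m}(z)\overline{z^k}\omega^{(j)}(z)\frac{|dz|}{2\pi}=0$ for $k=0,\dots,m_j-1$, $j=1,\dots,r$. The type I object is a nonzero vector of polynomials $(\Lambda_1,\dots,\Lambda_r)$ with $\deg\Lambda_j\le m_j-1$ such that the linear form $\Psi_{\vec m}(z)=\sum_{j=1}^r\Lambda_j(z)\omega^{(j)}(z)$ satisfies $\int_{\mathbb T}\Psi_{\vec m}(z)\overline{z^k}\frac{|dz|}{2\pi}=0$ for $k=0,\dots,|\vec m|-2$ and $=1$ for $k=|\vec m|-1$. The system is perfect if for every (nonzero) multi-index in $\mathbb N^r$ the type I and type II objects exist and are unique. Kernel of the multiple orthogonal system: let $\vec n_0=\vec 0,\vec n_1,\dots,\vec n_n=\vec n$ be the natural path, i.e. $|\vec n_j|=j$ and the path first increases the first component by unit steps from $0$ to $n_1$, then the second from $0$ to $n_2$, and so on. Then $\mathcal K(z,\xi)=\sum_{j=0}^{n-1}\Phi_{\vec n_j}(z)\overline{\Psi_{\vec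 n_{j+1}}(\xi)}$. Reference orthogonal polynomials: $\varphi_k$ is the monic polynomial of degree $k$ with $\int_{\mathbb T}\varphi_k(z)\overline{\varphi_m(z)}\omega^{(1)}(z)\frac{|dz|}{2\pi}=h_k\delta_{km}$, $h_k>0$, and $\mathcal K_0(z,\xi)=\sum_{j=0}^{n-1}\frac{\varphi_j(z)\overline{\varphi_j(\xi)}}{h_j}\omega^{(1)}(\xi)$. Vectors and matrices: $\boldsymbol\varphi(z)=(\varphi_0(z),\dots,\varphi_{n-1}(z))^\top$; $\boldsymbol\psi(z)$ is the $n$-column vector obtained by stacking, for $j=1,\dots,r$ in this order, the blocks $(\varphi_0(z)\omega^{(j)}(z),\dots,\varphi_{n_j-1}(z)\omega^{(j)}(z))^\top$; $\boldsymbol{\mathcal M}=\int_{\mathbb T}\boldsymbol\varphi(z)\overline{\boldsymbol\psi(z)}^\top\frac{|dz|}{2\pi}$. $\boldsymbol\varphi_2$ and $\boldsymbol\psi_2$ are the last $n-n_1$ components of $\boldsymbol\varphi$ and $\boldsymbol\psi$, and $\boldsymbol{\mathcal M}_{22}$ is the lower-right $(n-n_1)\times(n-n_1)$ block of $\boldsymbol{\mathcal M}$. *)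

theory Defs
  imports
    "HOL-Analysis.Analysis"
    "Jordan_Normal_Form.Matrix"
    "Jordan_Normal_Form.Conjugate"
    "Jordan_Normal_Form.Gauss_Jordan_Elimination"
begin

text \<open>
  Multi-indices in \<open>\<nat>\<^sup>r\<close> are functions \<open>nat \<Rightarrow> nat\<close> of which only the values on \<open>{1..r}\<close> are read,
  and the weights are \<open>\<omega> 1, \<dots>, \<omega> r\<close>.
\<close>

subsection \<open>Weights on the unit circle\<close>

text \<open>
  Normalized arclength \<open>\<bar>dz\<bar>/(2\<pi>)\<close>. The underlying space is the unit circle itself, so a weight
  needs no measurability off the circle; the completion admits all Lebesgue measurable weights.
\<close>
definition arclength :: "complex measure" where
  "arclength = completion (distr (uniform_measure lborel {0..2 * pi})
     (restrict_space borel (sphere 0 1)) cis)"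

text \<open>
  The moments are indexed by \<open>\<int>\<close>; the zeroth one gives integrability, hence measurability.
\<close>
definition weight :: "(complex \<Rightarrow> real) \<Rightarrow> bool" where
  "weight w \<longleftrightarrow> (\<forall>z\<in>sphere 0 1. 0 \<le> w z) \<and>
     (\<forall>k::int. integrable arclength (\<lambda>z. z powi k * complex_of_real (w z)))"

subsection \<open>Multiple orthogonal polynomials\<close>

definition mi_size :: "nat \<Rightarrow> (nat \<Rightarrow> nat) \<Rightarrow> nat" where
  "mi_size r m = (\<Sum>j=1..r. m j)"

definition type_II :: "nat \<Rightarrow> (nat \<Rightarrow> complex \<Rightarrow> real) \<Rightarrow> (nat \<Rightarrow> nat) \<Rightarrow> complex poly \<Rightarrow> bool" where
  "type_II r \<omega> m p \<longleftrightarrow> lead_coeff p = 1 \<and> degree p = mi_size r m \<and>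
     (\<forall>j\<in>{1..r}. \<forall>k<m j.
        (\<integral>z. poly p z * cnj (z ^ k) * complex_of_real (\<omega> j z) \<partial>arclength) = 0)"

definition linear_form ::
  "nat \<Rightarrow> (nat \<Rightarrow> complex \<Rightarrow> real) \<Rightarrow> (nat \<Rightarrow> complex poly) \<Rightarrow> complex \<Rightarrow> complex" where
  "linear_form r \<omega> L z = (\<Sum>j=1..r. poly (L j) z * complex_of_real (\<omega> j z))"

text \<open>
  The vector \<open>(\<Lambda>\<^sub>1, \<dots>, \<Lambda>\<^sub>r)\<close> is a function on \<open>nat\<close>, normalized to be \<open>0\<close> off \<open>{1..r}\<close> so that
  uniqueness of the vector is uniqueness of the function. The degree condition forces
  \<open>\<Lambda>\<^sub>j = 0\<close> when \<open>m\<^sub>j = 0\<close>.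
\<close>
definition type_I ::
  "nat \<Rightarrow> (nat \<Rightarrow> complex \<Rightarrow> real) \<Rightarrow> (nat \<Rightarrow> nat) \<Rightarrow> (nat \<Rightarrow> complex poly) \<Rightarrow> bool" where
  "type_I r \<omega> m L \<longleftrightarrow>
     (\<forall>j. j \<notin> {1..r} \<longrightarrow> L j = 0) \<and>
     (\<exists>j\<in>{1..r}. L j \<noteq> 0) \<and>
     (\<forall>j\<in>{1..r}. L j = 0 \<or> degree (L j) < m j) \<and>
     (\<forall>k. Suc k < mi_size r m \<longrightarrow>
        (\<integral>z. linear_form r \<omega> L z * cnj (z ^ k) \<partial>arclength) = 0) \<and>
     (\<integral>z. linear_form r \<omega> L z * cnj (z ^ (mi_size r m - 1)) \<partial>arclength) = 1"

definition perfect :: "nat \<Rightarrow> (nat \<Rightarrow> complex \<Rightarrow> real) \<Rightarrow> bool" where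
  "perfect r \<omega> \<longleftrightarrow>
     (\<forall>m. mi_size r m \<noteq> 0 \<longrightarrow> (\<exists>!L. type_I r \<omega> m L) \<and> (\<exists>!p. type_II r \<omega> m p))"

definition Phi :: "nat \<Rightarrow> (nat \<Rightarrow> complex \<Rightarrow> real) \<Rightarrow> (nat \<Rightarrow> nat) \<Rightarrow> complex poly" where
  "Phi r \<omega> m = (THE p. type_II r \<omega> m p)"

definition Psi :: "nat \<Rightarrow> (nat \<Rightarrow> complex \<Rightarrow> real) \<Rightarrow> (nat \<Rightarrow> nat) \<Rightarrow> complex \<Rightarrow> complex" where
  "Psi r \<omega> m = linear_form r \<omega> (THE L. type_I r \<omega> m L)"

text \<open>
  \<open>natural_path m j\<close> is the \<open>j\<close>-th point of the path that fills the first component up to \<open>m 1\<close>,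
  then the second up to \<open>m 2\<close>, and so on; the subtraction is truncated.
\<close>
definition natural_path :: "(nat \<Rightarrow> nat) \<Rightarrow> nat \<Rightarrow> nat \<Rightarrow> nat" where
  "natural_path m j i = min (m i) (j - (\<Sum>l=1..<i. m l))"

lemma mi_size_natural_path: "mi_size r (natural_path m j) = min (mi_size r m) j"
  unfolding mi_size_def
proof (induction r)
  case 0
  then show ?case by simp
next
  case (Suc r)
  have "(\<Sum>i=1..Suc r. natural_path m j i) =
      min (\<Sum>i=1..r. m i) j + min (m (Suc r)) (j - (\<Sum>i=1..r. m i))"
    using Suc by (simp add: natural_path_def atLeastLessThanSuc_atLeastAtMost)
  also have "\<dots> = min ((\<Sum>i=1..r. m i) + m (Suc r)) j" by linarith
  finally show ?case by simp
qed

definition CD_kernel ::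
  "nat \<Rightarrow> (nat \<Rightarrow> complex \<Rightarrow> real) \<Rightarrow> (nat \<Rightarrow> nat) \<Rightarrow> complex \<Rightarrow> complex \<Rightarrow> complex" where
  "CD_kernel r \<omega> m z \<xi> = (\<Sum>j<mi_size r m.
     poly (Phi r \<omega> (natural_path m j)) z * cnj (Psi r \<omega> (natural_path m (Suc j)) \<xi>))"

subsection \<open>Reference orthogonal polynomials\<close>

definition orthogonal_system ::
  "(complex \<Rightarrow> real) \<Rightarrow> (nat \<Rightarrow> complex poly) \<Rightarrow> (nat \<Rightarrow> real) \<Rightarrow> bool" where
  "orthogonal_system w \<phi> h \<longleftrightarrow>
     (\<forall>k. lead_coeff (\<phi> k) = 1 \<and> degree (\<phi> k) = k \<and> h k > 0) \<and>
     (\<forall>k m. (\<integral>z. poly (\<phi> k) z * cnj (poly (\<phi> m) z) * complex_of_real (w z) \<partial>arclength) =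
        (if k = m then complex_of_real (h k) else 0))"

definition orth_poly :: "(complex \<Rightarrow> real) \<Rightarrow> nat \<Rightarrow> complex poly" where
  "orth_poly w = (THE \<phi>. \<exists>h. orthogonal_system w \<phi> h)"

definition orth_norm :: "(complex \<Rightarrow> real) \<Rightarrow> nat \<Rightarrow> real" where
  "orth_norm w = (THE h. orthogonal_system w (orth_poly w) h)"

definition CD_kernel0 :: "(complex \<Rightarrow> real) \<Rightarrow> nat \<Rightarrow> complex \<Rightarrow> complex \<Rightarrow> complex" where
  "CD_kernel0 w n z \<xi> = (\<Sum>j<n. poly (orth_poly w j) z * cnj (poly (orth_poly w j) \<xi>) /
     complex_of_real (orth_norm w j) * complex_of_real (w \<xi>))"

subsection \<open>Vectors and matrices\<close>

definition phi_vec :: "(complex \<Rightarrow> real) \<Rightarrow> nat \<Rightarrow> complex \<Rightarrow> complex Matrix.vec" where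
  "phi_vec w n z = Matrix.vec n (\<lambda>k. poly (orth_poly w k) z)"

text \<open>All blocks are built from the orthogonal polynomials of the first weight.\<close>
definition psi_vec ::
  "nat \<Rightarrow> (nat \<Rightarrow> complex \<Rightarrow> real) \<Rightarrow> (nat \<Rightarrow> nat) \<Rightarrow> complex \<Rightarrow> complex Matrix.vec" where
  "psi_vec r \<omega> m z = vec_of_list (concat (map
     (\<lambda>j. map (\<lambda>k. poly (orth_poly (\<omega> 1) k) z * complex_of_real (\<omega> j z)) [0..<m j])
     [1..<Suc r]))"

definition moment_mat ::
  "nat \<Rightarrow> (nat \<Rightarrow> complex \<Rightarrow> real) \<Rightarrow> (nat \<Rightarrow> nat) \<Rightarrow> complex Matrix.mat" where
  "moment_mat r \<omega> m = Matrix.mat (mi_size r m) (mi_size r m) (\<lambda>(i, k).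
     \<integral>z. vec_index (phi_vec (\<omega> 1) (mi_size r m) z) i * cnj (vec_index (psi_vec r \<omega> m z) k)
       \<partial>arclength)"

definition phi_vec2 ::
  "nat \<Rightarrow> (nat \<Rightarrow> complex \<Rightarrow> real) \<Rightarrow> (nat \<Rightarrow> nat) \<Rightarrow> complex \<Rightarrow> complex Matrix.vec" where
  "phi_vec2 r \<omega> m z = vec_last (phi_vec (\<omega> 1) (mi_size r m) z) (mi_size r m - m 1)"

definition psi_vec2 ::
  "nat \<Rightarrow> (nat \<Rightarrow> complex \<Rightarrow> real) \<Rightarrow> (nat \<Rightarrow> nat) \<Rightarrow> complex \<Rightarrow> complex Matrix.vec" where
  "psi_vec2 r \<omega> m z = vec_last (psi_vec r \<omega> m z) (mi_size r m - m 1)"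

definition moment_mat22 ::
  "nat \<Rightarrow> (nat \<Rightarrow> complex \<Rightarrow> real) \<Rightarrow> (nat \<Rightarrow> nat) \<Rightarrow> complex Matrix.mat" where
  "moment_mat22 r \<omega> m =
     (case split_block (moment_mat r \<omega> m) (m 1) (m 1) of (A, B, C, D) \<Rightarrow> D)"

definition pi_vec ::
  "nat \<Rightarrow> (nat \<Rightarrow> complex \<Rightarrow> real) \<Rightarrow> (nat \<Rightarrow> nat) \<Rightarrow> complex \<Rightarrow> complex Matrix.vec" where
  "pi_vec r \<omega> m \<xi> = psi_vec2 r \<omega> m \<xi> - Matrix.vec (mi_size r m - m 1) (\<lambda>k.
     \<integral>s. cnj (CD_kernel0 (\<omega> 1) (mi_size r m) s \<xi>) * vec_index (psi_vec2 r \<omega> m s) k \<partial>arclength)"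

end

theory Submission
  imports Defs "Jordan_Normal_Form.Determinant"
begin

text \<open>
  The forms \<open>\<Psi>\<close> along the natural path lie in the span of the entries of \<open>\<psi>\<close>, so
  \<open>K(z, \<xi>) = \<Sum>\<^sub>k cnj (\<psi>\<^sub>k(\<xi>)) x\<^sub>k(z)\<close> for some functions \<open>x\<^sub>k\<close>. Biorthogonality of \<open>\<Phi>\<close> and \<open>\<Psi>\<close>
  makes \<open>K\<close> reproduce polynomials of degree below \<open>\<bar>n\<bar>\<close>, and applied to the entries of \<open>\<phi>\<close> this reads
  \<open>M x = \<phi>\<close>. The first \<open>n\<^sub>1\<close> columns of \<open>M\<close> are diagonal by orthogonality for \<open>\<omega>\<^sub>1\<close>, so the remaining
  rows say \<open>M\<^sub>2\<^sub>2 x\<^sub>2 = \<phi>\<^sub>2\<close>; since the entries of \<open>\<phi>\<^sub>2\<close> are linearly independent, \<open>M\<^sub>2\<^sub>2\<close> is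
  invertible. Substituting \<open>\<phi> = M x\<close> into \<open>K\<^sub>0\<close> cancels the terms \<open>x\<^sub>k\<close> with \<open>k < n\<^sub>1\<close> of \<open>K - K\<^sub>0\<close>, and the
  coefficients of the others are the entries of the conjugate of \<open>\<pi>\<close>.
\<close>

section \<open>The sesquilinear form of a weight\<close>

lemma space_arclength: "space arclength = sphere 0 1"
  by (simp add: arclength_def space_restrict_space)

text \<open>With polynomial arguments, integrability always follows from the moments. The type I and
  type II conditions, the reference orthogonality and the entries of M are all expressed through
  this form.\<close>

definition inner_wt :: "(complex \<Rightarrow> real) \<Rightarrow> complex poly \<Rightarrow> complex poly \<Rightarrow> complex" where
  "inner_wt w p q = (\<integral>z. poly p z * cnj (poly q z) * complex_of_real (w z) \<partial>arclength)"

text \<open>On the circle \<open>cnj z\<close> is the inverse of \<open>z\<close>, so the integrand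
  is a moment with an integer exponent. The space of \<open>arclength\<close> is the circle itself,
  so agreement there suffices.\<close>

lemma integrable_monomials:
  assumes "weight w"
  shows "integrable arclength (\<lambda>z. z ^ a * cnj (z ^ b) * complex_of_real (w z))"
proof -
  have "z ^ a * cnj (z ^ b) = z powi (int a - int b)" if "z \<in> sphere 0 1" for z :: complex
  proof -
    have "z * cnj z = 1"
      using that by (simp flip: complex_norm_square)
    then have z: "z \<noteq> 0" "cnj z = inverse z"
      by (auto simp: inverse_unique)
    then show ?thesis
      by (simp add: power_int_diff divide_inverse power_inverse)
  qed
  then have "integrable arclength (\<lambda>z. z ^ a * cnj (z ^ b) * complex_of_real (w z)) \<longleftrightarrow>
      integrable arclength (\<lambda>z. z powi (int a - int b) * complex_of_real (w z))"
    by (intro Bochner_Integration.integrable_cong refl) (simp_all add: space_arclength)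
  then show ?thesis
    using assms by (simp add: weight_def)
qed

lemma integrable_inner_wt:
  assumes "weight w"
  shows "integrable arclength (\<lambda>z. poly p z * cnj (poly q z) * complex_of_real (w z))"
proof -
  have "poly p z * cnj (poly q z) * complex_of_real (w z) =
      (\<Sum>i\<le>degree p. \<Sum>j\<le>degree q. coeff p i * cnj (coeff q j) *
        (z ^ i * cnj (z ^ j) * complex_of_real (w z)))" for z
    unfolding poly_altdef cnj_sum sum_product unfolding sum_distrib_right
    by (intro sum.cong refl) (simp add: mult_ac)
  then show ?thesis
    using integrable_monomials[OF assms] by simp
qed

lemma inner_wt_add_left:
  "weight w \<Longrightarrow> inner_wt w (p + p') q = inner_wt w p q + inner_wt w p' q"
  by (simp add: inner_wt_def distrib_right integrable_inner_wt)

lemma inner_wt_smult_left: "inner_wt w (Polynomial.smult c p) q = c * inner_wt w p q"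
  by (simp add: inner_wt_def mult.assoc)

lemma inner_wt_0_left [simp]: "inner_wt w 0 q = 0"
  by (simp add: inner_wt_def)

text \<open>The weight is real, so conjugation only exchanges the two polynomials. Rules for the
  left argument thereby carry over to the right one.\<close>

lemma inner_wt_cnj: "inner_wt w q p = cnj (inner_wt w p q)"
  unfolding inner_wt_def Bochner_Integration.integral_cnj[symmetric] by (simp add: mult_ac)

lemma inner_wt_sum_left:
  "weight w \<Longrightarrow> inner_wt w (\<Sum>i\<in>A. f i) q = (\<Sum>i\<in>A. inner_wt w (f i) q)"
  by (induction A rule: infinite_finite_induct) (auto simp: inner_wt_add_left)

lemma inner_wt_0_right [simp]: "inner_wt w p 0 = 0"
  by (simp add: inner_wt_def)

lemma inner_wt_sum_right:
  "weight w \<Longrightarrow> inner_wt w q (\<Sum>i\<in>A. f i) = (\<Sum>i\<in>A. inner_wt w q (f i))"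
  by (subst (1 2) inner_wt_cnj) (simp add: inner_wt_sum_left)

lemma inner_wt_smult_right: "inner_wt w q (Polynomial.smult c p) = cnj c * inner_wt w q p"
  by (subst (1 2) inner_wt_cnj) (simp add: inner_wt_smult_left)

lemma inner_wt_expand_right:
  assumes "weight w" "degree q \<le> n"
  shows "inner_wt w p q = (\<Sum>i\<le>n. cnj (coeff q i) * inner_wt w p (monom 1 i))"
proof -
  have "inner_wt w p q = inner_wt w p (\<Sum>i\<le>n. Polynomial.smult (coeff q i) (monom 1 i))"
    using assms(2) by (simp add: Polynomial.smult_monom poly_as_sum_of_monoms')
  then show ?thesis
    using assms(1) by (simp add: inner_wt_sum_right inner_wt_smult_right)
qed

text \<open>The disjunct \<open>q = 0\<close> is there because the zero polynomial has degree 0, so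
  for \<open>m = 0\<close> the degree bound alone would exclude it.\<close>

lemma inner_wt_eq_0_right:
  assumes "weight w" "\<And>k. k < m \<Longrightarrow> inner_wt w p (monom 1 k) = 0" "q = 0 \<or> degree q < m"
  shows "inner_wt w p q = 0"
  by (subst inner_wt_expand_right[OF assms(1) order.refl], rule sum.neutral) (use assms(2,3) in auto)

text \<open>A weight may vanish identically, so strict positivity cannot be had here; for the monic
  orthogonal polynomials it comes later from perfectness.\<close>

lemma inner_wt_self_nonneg:
  assumes "weight w"
  obtains h where "inner_wt w p p = complex_of_real h" "h \<ge> 0"
proof
  have "inner_wt w p p = (\<integral>z. complex_of_real ((cmod (poly p z))\<^sup>2 * w z) \<partial>arclength)"
    unfolding inner_wt_def by (intro Bochner_Integration.integral_cong) (simp_all flip: complex_norm_square)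
  then show "inner_wt w p p = complex_of_real (\<integral>z. (cmod (poly p z))\<^sup>2 * w z \<partial>arclength)"
    by (simp only: integral_complex_of_real)
  show "0 \<le> (\<integral>z. (cmod (poly p z))\<^sup>2 * w z \<partial>arclength)"
    using assms by (intro integral_nonneg_AE AE_I2) (auto simp: weight_def space_arclength)
qed

section \<open>Monic bases\<close>

text \<open>Subtracting the right multiple of \<open>q N\<close> removes the top coefficient; monic
  leading terms make this possible without division. It serves both the type II polynomials along
  the path and the reference polynomials.\<close>

lemma monic_basis_expansion:
  fixes q :: "nat \<Rightarrow> 'a::comm_ring_1 poly"
  assumes "\<And>j. j < N \<Longrightarrow> lead_coeff (q j) = 1" "\<And>j. j < N \<Longrightarrow> degree (q j) = j"
    and "p = 0 \<or> degree p < N"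
  shows "\<exists>a. p = (\<Sum>j<N. Polynomial.smult (a j) (q j))"
  using assms
proof (induction N arbitrary: p)
  case 0
  then show ?case by simp
next
  case (Suc N)
  let ?r = "p - Polynomial.smult (coeff p N) (q N)"
  have le: "degree ?r \<le> N"
    using Suc.prems(2)[of N] Suc.prems(3) by (intro degree_diff_le) (auto intro: order.trans[OF degree_smult_le])
  have "coeff ?r N = 0"
    using Suc.prems(1)[of N] Suc.prems(2)[of N] by simp
  then have "?r = 0 \<or> degree ?r < N"
    using le by (metis leading_coeff_0_iff le_neq_implies_less)
  then have "\<exists>a. ?r = (\<Sum>j<N. Polynomial.smult (a j) (q j))"
    by (intro Suc.IH Suc.prems(1,2) less_SucI)
  then obtain a where a: "?r = (\<Sum>j<N. Polynomial.smult (a j) (q j))" ..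
  then have "p = (\<Sum>j<N. Polynomial.smult (a j) (q j)) + Polynomial.smult (coeff p N) (q N)"
    by (metis diff_add_cancel)
  also have "\<dots> = (\<Sum>j<Suc N. Polynomial.smult ((a(N := coeff p N)) j) (q j))"
    by simp
  finally show ?case by (rule exI[where x = "a(N := coeff p N)"])
qed

text \<open>Only \<open>q N\<close> contributes to the coefficient at \<open>N\<close>, so the
  \<open>a j\<close> vanish from the top down.\<close>

lemma monic_basis_independent:
  fixes q :: "nat \<Rightarrow> 'a::comm_ring_1 poly"
  assumes "\<And>j. j < N \<Longrightarrow> lead_coeff (q j) = 1" "\<And>j. j < N \<Longrightarrow> degree (q j) = j"
    and "(\<Sum>j<N. Polynomial.smult (a j) (q j)) = 0" "j < N"
  shows "a j = 0"
  using assms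
proof (induction N)
  case 0
  then show ?case by simp
next
  case (Suc N)
  have "coeff (\<Sum>j<N. Polynomial.smult (a j) (q j)) N = 0"
    unfolding coeff_sum using Suc.prems(2) by (intro sum.neutral) (auto simp: coeff_eq_0)
  moreover have "coeff (q N) N = 1"
    using Suc.prems(1)[of N] Suc.prems(2)[of N] by simp
  ultimately have "a N = 0"
    using arg_cong[OF Suc.prems(3), of "\<lambda>p. coeff p N"] by simp
  with Suc show ?case by (cases "j = N") auto
qed

section \<open>The definitions in terms of the form\<close>

lemma type_II_iff:
  "type_II r \<omega> m p \<longleftrightarrow> lead_coeff p = 1 \<and> degree p = mi_size r m \<and>
     (\<forall>j\<in>{1..r}. \<forall>k<m j. inner_wt (\<omega> j) p (monom 1 k) = 0)"
  by (simp add: type_II_def inner_wt_def poly_monom)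

lemma integral_linear_form:
  assumes "\<forall>j\<in>{1..r}. weight (\<omega> j)"
  shows "(\<integral>z. linear_form r \<omega> L z * cnj (poly q z) \<partial>arclength) =
    (\<Sum>j=1..r. inner_wt (\<omega> j) (L j) q)"
proof -
  have "linear_form r \<omega> L z * cnj (poly q z) =
      (\<Sum>j=1..r. poly (L j) z * cnj (poly q z) * complex_of_real (\<omega> j z))" for z
    unfolding linear_form_def sum_distrib_right by (intro sum.cong refl) (simp add: mult_ac)
  then show ?thesis
    using assms by (simp add: inner_wt_def integrable_inner_wt)
qed

lemma type_I_D:
  assumes "\<forall>j\<in>{1..r}. weight (\<omega> j)" "type_I r \<omega> m L"
  shows "\<And>j. j \<in> {1..r} \<Longrightarrow> L j = 0 \<or> degree (L j) < m j"
    and "\<And>k. Suc k < mi_size r m \<Longrightarrow> (\<Sum>j=1..r. inner_wt (\<omega> j) (L j) (monom 1 k)) = 0"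
    and "(\<Sum>j=1..r. inner_wt (\<omega> j) (L j) (monom 1 (mi_size r m - 1))) = 1"
  using assms(2) unfolding integral_linear_form[OF assms(1), symmetric] type_I_def
  by (simp_all add: poly_monom)

text \<open>\<open>perfect\<close> speaks of nonzero multi-indices only, but the natural path starts
  at zero. There the orthogonality conditions are void and 1 is the only monic constant.\<close>

lemma ex1_type_II:
  assumes "perfect r \<omega>"
  shows "\<exists>!p. type_II r \<omega> m p"
proof (cases "mi_size r m = 0")
  case True
  then have "type_II r \<omega> m p \<longleftrightarrow> p = 1" for p
    by (auto simp: type_II_def mi_size_def elim!: degree_eq_zeroE)
  then show ?thesis by simp
next
  case False
  show ?thesis
    by (rule assms[unfolded perfect_def, THEN spec, THEN mp, OF False, THEN conjunct2])
qed

lemma type_II_Phi: "perfect r \<omega> \<Longrightarrow> type_II r \<omega> m (Phi r \<omega> m)"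
  unfolding Phi_def by (rule theI'[of "type_II r \<omega> m"]) (rule ex1_type_II)

lemma Phi_eqI: "perfect r \<omega> \<Longrightarrow> type_II r \<omega> m p \<Longrightarrow> Phi r \<omega> m = p"
  unfolding Phi_def by (rule the1_equality) (rule ex1_type_II)

lemma orthogonal_system_iff:
  "orthogonal_system w \<phi> h \<longleftrightarrow>
     (\<forall>k. lead_coeff (\<phi> k) = 1 \<and> degree (\<phi> k) = k \<and> h k > 0) \<and>
     (\<forall>k m. inner_wt w (\<phi> k) (\<phi> m) = (if k = m then complex_of_real (h k) else 0))"
  by (simp add: orthogonal_system_def inner_wt_def)

lemma orthogonal_systemD:
  assumes "orthogonal_system w \<phi> h"
  shows "lead_coeff (\<phi> k) = 1" "degree (\<phi> k) = k" "h k > 0"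
    "inner_wt w (\<phi> k) (\<phi> m) = (if k = m then complex_of_real (h k) else 0)"
proof -
  note * = assms[unfolded orthogonal_system_iff]
  show "lead_coeff (\<phi> k) = 1" "degree (\<phi> k) = k" "h k > 0"
    using conjunct1[OF *, THEN spec[of _ k]] by blast+
  show "inner_wt w (\<phi> k) (\<phi> m) = (if k = m then complex_of_real (h k) else 0)"
    by (rule conjunct2[OF *, THEN spec, THEN spec])
qed

section \<open>Biorthogonality\<close>

context
  fixes r :: nat and \<omega> :: "nat \<Rightarrow> complex \<Rightarrow> real"
  assumes wt: "\<forall>j\<in>{1..r}. weight (\<omega> j)" and perf: "perfect r \<omega>"
begin

text \<open>\<open>Psi\<close> exposes only the linear form, whereas the degree bounds concern the
  single components of the type I vector.\<close>

definition Lam :: "(nat \<Rightarrow> nat) \<Rightarrow> nat \<Rightarrow> complex poly" where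
  "Lam m = (THE L. type_I r \<omega> m L)"

lemma type_I_Lam:
  assumes "mi_size r m \<noteq> 0"
  shows "type_I r \<omega> m (Lam m)"
  unfolding Lam_def
  by (rule theI'[of "type_I r \<omega> m"])
    (rule perf[unfolded perfect_def, THEN spec, THEN mp, OF assms, THEN conjunct1])

lemma Psi_eq: "Psi r \<omega> m = linear_form r \<omega> (Lam m)"
  by (simp add: Psi_def Lam_def)

text \<open>The sum over \<open>l\<close> is the integral of Phi_i against the conjugate of
  Psi_(j+1). For \<open>i \<le> j\<close> the type I conditions of size \<open>j + 1\<close> apply
  to the monomials of Phi_i; for \<open>i > j\<close> the path is monotone, so type II orthogonality
  of Phi_i kills every term.\<close>

lemma Phi_Psi_biorthogonal:
  assumes "i < mi_size r n" "j < mi_size r n"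
  shows "(\<Sum>l=1..r. inner_wt (\<omega> l) (Phi r \<omega> (natural_path n i)) (Lam (natural_path n (Suc j)) l)) =
    (if i = j then 1 else 0)"
proof -
  let ?P = "Phi r \<omega> (natural_path n i)" and ?L = "Lam (natural_path n (Suc j))"
  have szi: "mi_size r (natural_path n i) = i" and szj: "mi_size r (natural_path n (Suc j)) = Suc j"
    using assms by (simp_all add: mi_size_natural_path)
  have P: "type_II r \<omega> (natural_path n i) ?P"
    by (rule type_II_Phi[OF perf])
  have L: "type_I r \<omega> (natural_path n (Suc j)) ?L"
    by (rule type_I_Lam) (simp add: szj)
  note L = type_I_D[OF wt L, unfolded szj]
  show ?thesis
  proof (cases "i \<le> j")
    case True
    have lc: "coeff ?P i = 1" and deg: "degree ?P = i"
      using P szi by (auto simp: type_II_iff)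
    have "(\<Sum>l=1..r. inner_wt (\<omega> l) (?L l) ?P) =
        (\<Sum>l=1..r. \<Sum>k\<le>i. cnj (coeff ?P k) * inner_wt (\<omega> l) (?L l) (monom 1 k))"
      using wt deg by (intro sum.cong inner_wt_expand_right) auto
    also have "\<dots> = (\<Sum>k\<le>i. cnj (coeff ?P k) * (\<Sum>l=1..r. inner_wt (\<omega> l) (?L l) (monom 1 k)))"
      by (subst sum.swap) (simp add: sum_distrib_left)
    also have "\<dots> = (\<Sum>k\<le>i. if k = j then 1 else 0)"
    proof (intro sum.cong refl)
      \<comment> \<open>As \<open>k \<le> i \<le> j\<close>, either \<open>k < j\<close> and
        orthogonality gives 0, or \<open>k = i = j\<close> and the normalization meets the leading
        coefficient 1.\<close>
      fix k assume "k \<in> {..i}"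
      with True consider "Suc k < Suc j" | "k = j" "i = j" by fastforce
      then show "cnj (coeff ?P k) * (\<Sum>l=1..r. inner_wt (\<omega> l) (?L l) (monom 1 k)) =
          (if k = j then 1 else 0)"
      proof cases
        case 1
        then show ?thesis by (subst L(2)) auto
      next
        case 2
        then show ?thesis using L(3) lc by simp
      qed
    qed
    also have "\<dots> = (if i = j then 1 else 0)"
      using True by auto
    finally have eq: "(\<Sum>l=1..r. inner_wt (\<omega> l) (?L l) ?P) = (if i = j then 1 else 0)" .
    \<comment> \<open>The type I conditions have the monomials on the right, hence the computation
      with exchanged arguments; its value is real, so conjugating back changes nothing.\<close>
    have "(\<Sum>l=1..r. inner_wt (\<omega> l) ?P (?L l)) = cnj (\<Sum>l=1..r. inner_wt (\<omega> l) (?L l) ?P)"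
      unfolding cnj_sum by (intro sum.cong refl inner_wt_cnj)
    then show ?thesis
      unfolding eq by simp
  next
    case False
    have "inner_wt (\<omega> l) ?P (?L l) = 0" if l: "l \<in> {1..r}" for l
    proof (rule inner_wt_eq_0_right)
      show "weight (\<omega> l)" using wt l by blast
      show "inner_wt (\<omega> l) ?P (monom 1 k) = 0" if "k < natural_path n i l" for k
        using P l that by (auto simp: type_II_iff)
      have "natural_path n (Suc j) l \<le> natural_path n i l"
        using False unfolding natural_path_def by (intro min.mono diff_le_mono) auto
      then show "?L l = 0 \<or> degree (?L l) < natural_path n i l"
        using L(1)[OF l] by auto
    qed
    then show ?thesis
      using False by simp
  qed
qed

text \<open>The Phi along the path have degrees 0, 1, 2 and so on, hence form a basis in which
  \<open>p\<close> expands; biorthogonality reads off its coefficients.\<close>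

lemma kernel_reproducing:
  assumes p: "p = 0 \<or> degree p < mi_size r n"
  shows "poly p z = (\<Sum>j<mi_size r n. poly (Phi r \<omega> (natural_path n j)) z *
    (\<Sum>l=1..r. inner_wt (\<omega> l) p (Lam (natural_path n (Suc j)) l)))"
proof -
  let ?N = "mi_size r n" and ?P = "\<lambda>j. Phi r \<omega> (natural_path n j)"
    and ?L = "\<lambda>j. Lam (natural_path n (Suc j))"
  have "lead_coeff (?P j) = 1" "degree (?P j) = j" if "j < ?N" for j
    using type_II_Phi[OF perf, of "natural_path n j"] that
    by (auto simp: type_II_iff mi_size_natural_path)
  then have "\<exists>a. p = (\<Sum>i<?N. Polynomial.smult (a i) (?P i))"
    by (intro monic_basis_expansion p)
  then obtain a where a: "p = (\<Sum>i<?N. Polynomial.smult (a i) (?P i))" ..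
  have "(\<Sum>l=1..r. inner_wt (\<omega> l) p (?L j l)) = a j" if "j < ?N" for j
  proof -
    have "(\<Sum>l=1..r. inner_wt (\<omega> l) p (?L j l)) =
        (\<Sum>l=1..r. \<Sum>i<?N. a i * inner_wt (\<omega> l) (?P i) (?L j l))"
      unfolding a using wt by (intro sum.cong) (simp_all add: inner_wt_sum_left inner_wt_smult_left)
    also have "\<dots> = (\<Sum>i<?N. a i * (\<Sum>l=1..r. inner_wt (\<omega> l) (?P i) (?L j l)))"
      by (subst sum.swap) (simp add: sum_distrib_left)
    also have "\<dots> = (\<Sum>i<?N. if i = j then a j else 0)"
      using that by (intro sum.cong) (auto simp: Phi_Psi_biorthogonal simp del: One_nat_def)
    also have "\<dots> = a j" using that by simp
    finally show ?thesis .
  qed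
  note coeffs = this
  have "poly p z = (\<Sum>j<?N. a j * poly (?P j) z)"
    by (subst a) (simp add: poly_sum)
  also have "\<dots> = (\<Sum>j<?N. poly (?P j) z * (\<Sum>l=1..r. inner_wt (\<omega> l) p (?L j l)))"
    by (intro sum.cong refl) (simp only: coeffs lessThan_iff mult.commute)
  finally show ?thesis .
qed

text \<open>Along the path the component \<open>l\<close> of a type I vector has degree below
  \<open>n l\<close>, so it expands in the \<phi>_k with \<open>k < n l\<close>. Collecting the
  coefficients gives \<open>x\<close>, and the second property is the reproducing property in these
  coordinates.\<close>

lemma kernel_expansion:
  assumes \<phi>: "\<And>k. lead_coeff (\<phi> k) = 1" "\<And>k. degree (\<phi> k) = k"
  obtains x :: "nat \<Rightarrow> nat \<Rightarrow> complex \<Rightarrow> complex"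
  where "\<And>z \<xi>. CD_kernel r \<omega> n z \<xi> =
      (\<Sum>l=1..r. \<Sum>k<n l. cnj (poly (\<phi> k) \<xi>) * complex_of_real (\<omega> l \<xi>) * x l k z)"
    and "\<And>p z. degree p < mi_size r n \<Longrightarrow>
      poly p z = (\<Sum>l=1..r. \<Sum>k<n l. inner_wt (\<omega> l) p (\<phi> k) * x l k z)"
proof -
  let ?N = "mi_size r n" and ?P = "\<lambda>j. Phi r \<omega> (natural_path n j)"
    and ?L = "\<lambda>j. Lam (natural_path n (Suc j))"
  have "\<exists>c. ?L j l = (\<Sum>k<n l. Polynomial.smult (c k) (\<phi> k))" if "j < ?N" "l \<in> {1..r}" for j l
  proof (intro monic_basis_expansion \<phi>)
    have "type_I r \<omega> (natural_path n (Suc j)) (?L j)"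
      using that(1) by (intro type_I_Lam) (simp add: mi_size_natural_path)
    from type_I_D(1)[OF wt this that(2)] show "?L j l = 0 \<or> degree (?L j l) < n l"
      by (auto simp: natural_path_def)
  qed
  note ex = this
  define c where "c j l = (SOME c. ?L j l = (\<Sum>k<n l. Polynomial.smult (c k) (\<phi> k)))" for j l
  have c: "?L j l = (\<Sum>k<n l. Polynomial.smult (c j l k) (\<phi> k))" if "j < ?N" "l \<in> {1..r}" for j l
    unfolding c_def by (rule someI_ex[OF ex[OF that]])
  define x where "x l k z = (\<Sum>j<?N. poly (?P j) z * cnj (c j l k))" for l k z
  \<comment> \<open>Used twice: with the conjugated entries of \<psi>(\<xi>) as \<open>f\<close> for
    the kernel, and with the inner products of \<open>p\<close> for its reproducing
    property.\<close>
  have swap: "(\<Sum>j<?N. poly (?P j) z * (\<Sum>l=1..r. \<Sum>k<n l. cnj (c j l k) * f l k)) =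
      (\<Sum>l=1..r. \<Sum>k<n l. f l k * x l k z)" for f z
  proof -
    have "(\<Sum>j<?N. poly (?P j) z * (\<Sum>l=1..r. \<Sum>k<n l. cnj (c j l k) * f l k)) =
        (\<Sum>j<?N. \<Sum>l=1..r. \<Sum>k<n l. f l k * (poly (?P j) z * cnj (c j l k)))"
      by (simp add: sum_distrib_left mult_ac)
    also have "\<dots> = (\<Sum>l=1..r. \<Sum>j<?N. \<Sum>k<n l. f l k * (poly (?P j) z * cnj (c j l k)))"
      by (rule sum.swap)
    also have "\<dots> = (\<Sum>l=1..r. \<Sum>k<n l. \<Sum>j<?N. f l k * (poly (?P j) z * cnj (c j l k)))"
      by (rule sum.cong[OF refl], rule sum.swap)
    finally show ?thesis
      by (simp add: x_def sum_distrib_left)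
  qed
  show thesis
  proof
    fix z \<xi>
    have "cnj (Psi r \<omega> (natural_path n (Suc j)) \<xi>) =
        (\<Sum>l=1..r. \<Sum>k<n l. cnj (c j l k) * (cnj (poly (\<phi> k) \<xi>) * complex_of_real (\<omega> l \<xi>)))"
      if "j < ?N" for j
    proof -
      have "cnj (Psi r \<omega> (natural_path n (Suc j)) \<xi>) =
          (\<Sum>l=1..r. cnj (poly (?L j l) \<xi>) * complex_of_real (\<omega> l \<xi>))"
        by (simp add: Psi_eq linear_form_def)
      also have "\<dots> = (\<Sum>l=1..r. \<Sum>k<n l. cnj (c j l k) * (cnj (poly (\<phi> k) \<xi>) * complex_of_real (\<omega> l \<xi>)))"
        using that c by (intro sum.cong refl) (simp add: poly_sum sum_distrib_right mult.assoc)
      finally show ?thesis .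
    qed
    then show "CD_kernel r \<omega> n z \<xi> =
        (\<Sum>l=1..r. \<Sum>k<n l. cnj (poly (\<phi> k) \<xi>) * complex_of_real (\<omega> l \<xi>) * x l k z)"
      unfolding CD_kernel_def swap[symmetric] by (intro sum.cong) simp_all
  next
    fix p :: "complex poly" and z
    assume p: "degree p < ?N"
    have "(\<Sum>l=1..r. inner_wt (\<omega> l) p (?L j l)) =
        (\<Sum>l=1..r. \<Sum>k<n l. cnj (c j l k) * inner_wt (\<omega> l) p (\<phi> k))" if "j < ?N" for j
      using that c wt by (intro sum.cong) (simp_all add: inner_wt_sum_right inner_wt_smult_right)
    then show "poly p z = (\<Sum>l=1..r. \<Sum>k<n l. inner_wt (\<omega> l) p (\<phi> k) * x l k z)"
      unfolding swap[symmetric] using p by (subst kernel_reproducing[of _ n]) simp_all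
  qed
qed

section \<open>The reference orthogonal polynomials\<close>

text \<open>At the multi-index (k, 0, ..., 0) the type II polynomial is the monic orthogonal
  polynomial of degree k for the first weight. Perfectness thus yields existence, uniqueness and
  nonzero norms, so both definite descriptions denote.\<close>

lemma orthogonal_system_orth_poly:
  assumes r: "1 \<le> r"
  shows "orthogonal_system (\<omega> 1) (orth_poly (\<omega> 1)) (orth_norm (\<omega> 1))"
proof -
  define w where "w = \<omega> 1"
  have w: "weight w" using wt r by (simp add: w_def)
  define e where "e k = (\<lambda>i::nat. if i = 1 then k else 0)" for k :: nat
  have size: "mi_size r (e k) = k" for k
    using r by (simp add: mi_size_def e_def)
  have e_iff: "type_II r \<omega> (e k) p \<longleftrightarrow> lead_coeff p = 1 \<and> degree p = k \<and>
      (\<forall>i<k. inner_wt w p (monom 1 i) = 0)" for k p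
    using r unfolding type_II_iff size by (auto simp: e_def w_def)
  have uniq: "p = q" if "type_II r \<omega> (e k) p" "type_II r \<omega> (e k) q" for k p q
    using Phi_eqI[OF perf that(1)] Phi_eqI[OF perf that(2)] by simp
  define P where "P k = Phi r \<omega> (e k)" for k
  have P_II: "type_II r \<omega> (e k) (P k)" for k
    unfolding P_def by (rule type_II_Phi[OF perf])
  have P_lc: "lead_coeff (P k) = 1" and P_deg: "degree (P k) = k" for k
    using conjunct1[OF P_II[of k, unfolded e_iff]]
      conjunct1[OF conjunct2[OF P_II[of k, unfolded e_iff]]] .
  have P_mon: "inner_wt w (P k) (monom 1 i) = 0" if "i < k" for i k
    using P_II[of k] that by (simp add: e_iff)
  have P_orth: "inner_wt w (P k) q = 0" if "degree q < k" for k q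
    by (rule inner_wt_eq_0_right[OF w, of k]) (use that P_mon in simp_all)
  \<comment> \<open>If \<open>P k\<close> had norm \<open>0\<close>, then \<open>P (k + 1) + P k\<close> would be a second type II polynomial.\<close>
  have P_norm: "inner_wt w (P k) (P k) \<noteq> 0" for k
  proof
    assume "inner_wt w (P k) (P k) = 0"
    \<comment> \<open>The lower monomials are orthogonal to \<open>P k\<close> and its leading
      coefficient is 1, so the squared norm is the pairing with z^k alone.\<close>
    moreover have "inner_wt w (P k) (P k) = (\<Sum>i\<le>k. if i = k then inner_wt w (P k) (monom 1 k) else 0)"
      by (subst inner_wt_expand_right[OF w eq_refl[OF P_deg]], rule sum.cong)
        (use P_lc[of k] in \<open>auto simp: P_mon P_deg\<close>)
    ultimately have "inner_wt w (P k) (monom 1 k) = 0"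
      by simp
    then have "inner_wt w (P k) (monom 1 i) = 0" if "i < Suc k" for i
      using P_mon that by (cases "i = k") simp_all
    moreover have "degree (P (Suc k) + P k) = Suc k"
      by (subst degree_add_eq_left) (simp_all add: P_deg)
    moreover have "coeff (P (Suc k) + P k) (Suc k) = 1"
      using P_lc[of "Suc k"] by (simp add: coeff_eq_0 P_deg)
    ultimately have "type_II r \<omega> (e (Suc k)) (P (Suc k) + P k)"
      by (simp add: e_iff inner_wt_add_left[OF w] P_mon)
    then have "P (Suc k) + P k = P (Suc k)"
      by (rule uniq[OF _ P_II])
    then have "P k = 0"
      by simp
    then show False
      using P_lc[of k] by simp
  qed
  have "\<exists>h. inner_wt w (P k) (P k) = complex_of_real h \<and> h > 0" for k
  proof (rule inner_wt_self_nonneg[OF w, of "P k"])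
    fix h assume "inner_wt w (P k) (P k) = complex_of_real h" "h \<ge> 0"
    with P_norm[of k] show ?thesis by (intro exI[of _ h]) auto
  qed
  then obtain h where h: "\<And>k. inner_wt w (P k) (P k) = complex_of_real (h k)" "\<And>k. h k > 0"
    by metis
  have "inner_wt w (P k) (P m) = 0" if "k \<noteq> m" for k m
  proof (cases "k < m")
    case True
    then show ?thesis
      by (subst inner_wt_cnj) (simp add: P_orth P_deg)
  next
    case False
    with that show ?thesis by (simp add: P_orth P_deg)
  qed
  then have sys: "orthogonal_system w P h"
    unfolding orthogonal_system_iff by (intro conjI allI P_lc P_deg h(2)) (simp add: h(1))
  \<comment> \<open>Uniqueness: monomials of degree below \<open>k\<close> are combinations of
    earlier members of the system, so \<phi>_k satisfies the type II conditions at
    \<open>e k\<close>.\<close>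
  have "\<phi> = P" if "orthogonal_system w \<phi> h'" for \<phi> h'
  proof
    fix k
    note \<phi> = orthogonal_systemD[OF that]
    have "inner_wt w (\<phi> k) (monom 1 i) = 0" if "i < k" for i
    proof -
      have "\<exists>a. monom 1 i = (\<Sum>j<k. Polynomial.smult (a j) (\<phi> j))"
        using that by (intro monic_basis_expansion \<phi>(1,2)) (simp add: degree_monom_eq)
      then obtain a where a: "monom 1 i = (\<Sum>j<k. Polynomial.smult (a j) (\<phi> j))" ..
      show ?thesis
        unfolding a by (simp add: w inner_wt_sum_right inner_wt_smult_right \<phi>(4))
    qed
    then have "type_II r \<omega> (e k) (\<phi> k)"
      unfolding e_iff using \<phi>(1)[of k] \<phi>(2)[of k] by blast
    then show "\<phi> k = P k"
      by (rule uniq[OF _ P_II])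
  qed
  then have poly: "orth_poly w = P"
    unfolding orth_poly_def using sys by (intro the_equality) blast+
  have "orth_norm w = h"
    unfolding orth_norm_def poly
  proof (rule the_equality[where P = "orthogonal_system w P", OF sys])
    fix h' assume h': "orthogonal_system w P h'"
    show "h' = h"
    proof
      fix k
      have "complex_of_real (h' k) = complex_of_real (h k)"
        by (subst h(1)[symmetric]) (simp add: orthogonal_systemD(4)[OF h'])
      then show "h' k = h k" by simp
    qed
  qed
  with sys poly show ?thesis by (simp add: w_def)
qed

end

section \<open>Matrices\<close>

text \<open>A vector \<open>v\<close> with \<open>transpose_mat A *\<^sub>v v = 0\<close> is
  orthogonal to every \<open>A *\<^sub>v y z = u z\<close>, hence zero by independence. So
  solvability for the whole family \<open>u\<close> already forces invertibility.\<close>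

lemma mat_inverse_solve:
  fixes A :: "'a::field mat" and u y :: "'z \<Rightarrow> 'a Matrix.vec"
  assumes A: "A \<in> carrier_mat m m" and y: "\<And>z. y z \<in> carrier_vec m"
    and eq: "\<And>z. A *\<^sub>v y z = u z"
    and indep: "\<forall>v\<in>carrier_vec m. (\<forall>z. scalar_prod v (u z) = 0) \<longrightarrow> v = 0\<^sub>v m"
  shows "invertible_mat A" and "the (mat_inverse A) *\<^sub>v u z = y z"
proof -
  have "Determinant.det (transpose_mat A) \<noteq> 0"
  proof
    assume "Determinant.det (transpose_mat A) = 0"
    then obtain v where v: "v \<in> carrier_vec m" "v \<noteq> 0\<^sub>v m" "transpose_mat A *\<^sub>v v = 0\<^sub>v m"
      using det_0_iff_vec_prod_zero_field[of "transpose_mat A" m] A by auto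
    have "scalar_prod v (u z) = 0" for z
      using transpose_vec_mult_scalar[OF A y v(1), of z] v(3) y[of z] by (simp add: eq)
    with indep v show False by blast
  qed
  then have "Determinant.det A \<noteq> 0"
    using det_transpose[OF A] by simp
  then have "A \<in> Units (ring_mat TYPE('a) m ())"
    by (rule det_non_zero_imp_unit[OF A])
  then obtain B where B: "mat_inverse A = Some B"
    using mat_inverse(1)[OF A, where b = "()"] by (cases "mat_inverse A") auto
  note inv = mat_inverse(2)[OF A B]
  show "invertible_mat A"
    unfolding invertible_mat_def inverts_mat_def using inv A by auto
  have "B *\<^sub>v u z = (B * A) *\<^sub>v y z"
    using inv A y by (subst assoc_mult_mat_vec) (auto simp: eq)
  then show "the (mat_inverse A) *\<^sub>v u z = y z"
    using inv y by (simp add: B)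
qed

text \<open>The order is that of \<open>psi_vec\<close>: a position in \<psi> gives its weight and
  degree, and sums over positions become double sums.\<close>

definition block_index :: "nat \<Rightarrow> (nat \<Rightarrow> nat) \<Rightarrow> (nat \<times> nat) list" where
  "block_index r n = concat (map (\<lambda>l. map (Pair l) [0..<n l]) [1..<Suc r])"

lemma sum_list_block_index:
  "sum_list (map f (block_index r n)) = (\<Sum>l=1..r. \<Sum>k<n l. f (l, k))"
proof -
  have "sum_list (map f (concat xss)) = sum_list (map (\<lambda>xs. sum_list (map f xs)) xss)" for xss
    by (induction xss) auto
  then have "sum_list (map f (block_index r n)) =
      sum_list (map (\<lambda>l. sum_list (map (\<lambda>k. f (l, k)) [0..<n l])) [1..<Suc r])"
    by (simp add: block_index_def o_def del: upt_Suc)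
  then show ?thesis
    by (simp add: interv_sum_list_conv_sum_set_nat atLeastLessThanSuc_atLeastAtMost
        atLeast0LessThan del: upt_Suc)
qed

lemma length_block_index: "length (block_index r n) = mi_size r n"
  using sum_list_block_index[of "\<lambda>_. 1 :: nat" r n]
  by (simp add: mi_size_def sum_list_triv)

lemma sum_block_index:
  "(\<Sum>i<mi_size r n. f (block_index r n ! i)) = (\<Sum>l=1..r. \<Sum>k<n l. f (l, k))"
  unfolding sum_list_block_index[symmetric]
  by (simp add: sum_list_sum_nth length_block_index atLeast0LessThan)

text \<open>In the first block, position and degree coincide and the weight is the reference one;
  this makes the first \<open>n 1\<close> columns of M diagonal.\<close>

lemma block_index_first:
  assumes "1 \<le> r" "i < n 1"
  shows "block_index r n ! i = (1, i)"
proof -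
  have "[1..<Suc r] = 1 # [2..<Suc r]"
    using assms(1) by (subst upt_conv_Cons) (auto simp: numeral_2_eq_2)
  then have "block_index r n = map (Pair 1) [0..<n 1] @ concat (map (\<lambda>l. map (Pair l) [0..<n l]) [2..<Suc r])"
    by (simp add: block_index_def del: upt_Suc)
  then show ?thesis
    using assms(2) by (simp add: nth_append)
qed

lemma block_index_fst:
  assumes "i < mi_size r n"
  shows "fst (block_index r n ! i) \<in> {1..r}"
proof -
  have "block_index r n ! i \<in> set (block_index r n)"
    using assms by (simp add: length_block_index)
  then show ?thesis
    by (auto simp: block_index_def)
qed

lemma psi_vec_block_index:
  "psi_vec r \<omega> n z = Matrix.vec (mi_size r n) (\<lambda>i. case block_index r n ! i of (l, k) \<Rightarrow>
     poly (orth_poly (\<omega> 1) k) z * complex_of_real (\<omega> l z))"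
proof -
  have "psi_vec r \<omega> n z = vec_of_list (map (\<lambda>(l, k).
      poly (orth_poly (\<omega> 1) k) z * complex_of_real (\<omega> l z)) (block_index r n))"
    by (simp add: psi_vec_def block_index_def map_concat o_def del: upt_Suc)
  then show ?thesis
    by (intro eq_vecI) (simp_all add: length_block_index vec_of_list_index)
qed

lemma sum_lessThan_split:
  fixes f :: "nat \<Rightarrow> 'a::comm_monoid_add"
  assumes "a \<le> b"
  shows "(\<Sum>k<b. f k) = (\<Sum>k<a. f k) + (\<Sum>k<b - a. f (k + a))"
  using sum.atLeastLessThan_concat[of 0 a b f] sum.shift_bounds_nat_ivl[of f 0 a "b - a"] assms
  by (simp add: atLeast0LessThan)

section \<open>The difference of the two kernels\<close>

theorem theorem3p7:
  fixes r :: nat and \<omega> :: "nat \<Rightarrow> complex \<Rightarrow> real" and n :: "nat \<Rightarrow> nat"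
  assumes "r \<ge> 2"
    and "\<forall>j\<in>{1..r}. weight (\<omega> j)"
    and "perfect r \<omega>"
    and "mi_size r n \<ge> 1"
  shows "invertible_mat (moment_mat22 r \<omega> n) \<and>
    (\<forall>z. \<forall>\<xi>\<in>sphere 0 1.
       CD_kernel r \<omega> n z \<xi> - CD_kernel0 (\<omega> 1) (mi_size r n) z \<xi> =
       scalar_prod (conjugate (pi_vec r \<omega> n \<xi>))
         (the (mat_inverse (moment_mat22 r \<omega> n)) *\<^sub>v phi_vec2 r \<omega> n z))"
proof -
  define N where "N = mi_size r n"
  define m where "m = N - n 1"
  define \<phi> where "\<phi> = orth_poly (\<omega> 1)"
  define h where "h = orth_norm (\<omega> 1)"
  define l where "l i = fst (block_index r n ! i)" for i
  define b where "b i = snd (block_index r n ! i)" for i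
  \<comment> \<open>\<open>G\<close> and \<open>\<psi>\<close> are the entries of M and of the
    vector \<psi>; \<open>D j \<xi>\<close> is the coefficient of \<phi>_j in K_0(., \<xi>).\<close>
  define G where "G i k = inner_wt (\<omega> (l k)) (\<phi> i) (\<phi> (b k))" for i k
  define \<psi> where "\<psi> k \<xi> = poly (\<phi> (b k)) \<xi> * complex_of_real (\<omega> (l k) \<xi>)" for k \<xi>
  define D where "D j \<xi> = cnj (poly (\<phi> j) \<xi>) / complex_of_real (h j) * complex_of_real (\<omega> 1 \<xi>)" for j \<xi>
  have r: "1 \<le> r" using assms(1) by simp
  have "n 1 \<le> (\<Sum>j=1..r. n j)"
    using r by (intro member_le_sum) auto
  then have n1: "n 1 \<le> N"
    by (simp add: N_def mi_size_def)
  have first: "l k = 1" "b k = k" if "k < n 1" for k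
    using block_index_first[of r k n] r that by (simp_all add: l_def b_def)
  have wt: "weight (\<omega> (l k))" if "k < N" for k
    using block_index_fst[of k r n] that assms(2) by (auto simp: l_def N_def)
  note sys = orthogonal_systemD[OF orthogonal_system_orth_poly[OF assms(2,3) r], folded \<phi>_def h_def]

  obtain x where
    x1: "\<And>z \<xi>. CD_kernel r \<omega> n z \<xi> =
      (\<Sum>l=1..r. \<Sum>k<n l. cnj (poly (\<phi> k) \<xi>) * complex_of_real (\<omega> l \<xi>) * x l k z)" and
    x2: "\<And>p z. degree p < mi_size r n \<Longrightarrow>
      poly p z = (\<Sum>l=1..r. \<Sum>k<n l. inner_wt (\<omega> l) p (\<phi> k) * x l k z)"
    using kernel_expansion[OF assms(2,3) sys(1,2)] by blast
  define X where "X k z = x (l k) (b k) z" for k z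
  have kernel: "CD_kernel r \<omega> n z \<xi> = (\<Sum>k<N. cnj (\<psi> k \<xi>) * X k z)" for z \<xi>
    unfolding x1 N_def \<psi>_def X_def l_def b_def
    using sum_block_index[of "\<lambda>p. cnj (poly (\<phi> (snd p)) \<xi>) * complex_of_real (\<omega> (fst p) \<xi>) *
        x (fst p) (snd p) z" r n]
    by simp
  have expand: "poly (\<phi> i) z = (\<Sum>k<N. G i k * X k z)" if "i < N" for i z
    unfolding N_def G_def X_def l_def b_def
    using sum_block_index[of "\<lambda>p. inner_wt (\<omega> (fst p)) (\<phi> i) (\<phi> (snd p)) *
        x (fst p) (snd p) z" r n] x2[of "\<phi> i" z] that
    by (simp add: sys(2) N_def)
  have G_first: "G i k = (if i = k then complex_of_real (h k) else 0)" if "k < n 1" for i k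
    using that by (simp add: G_def first sys(4)[unfolded One_nat_def])

  have phi2: "phi_vec2 r \<omega> n z = Matrix.vec m (\<lambda>i. poly (\<phi> (i + n 1)) z)" for z
    using n1 by (intro eq_vecI)
      (auto simp: phi_vec2_def vec_last_def phi_vec_def m_def N_def \<phi>_def add.commute)
  have psi2: "psi_vec2 r \<omega> n z = Matrix.vec m (\<lambda>i. \<psi> (i + n 1) z)" for z
    using n1 by (intro eq_vecI)
      (auto simp: psi_vec2_def vec_last_def psi_vec_block_index m_def N_def \<phi>_def \<psi>_def l_def b_def
        add.commute case_prod_beta)
  have M22: "moment_mat22 r \<omega> n = Matrix.mat m m (\<lambda>(i, k). G (i + n 1) (k + n 1))"
    using n1 by (intro eq_matI)
      (auto simp: moment_mat22_def split_block_def Let_def moment_mat_def phi_vec_def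
        psi_vec_block_index m_def N_def \<phi>_def l_def b_def G_def inner_wt_def case_prod_beta mult.assoc)
  \<comment> \<open>These are the rows of M x = \<phi> with index at least \<open>n 1\<close>; there
    the first \<open>n 1\<close> columns are zero, being diagonal.\<close>
  have solve: "moment_mat22 r \<omega> n *\<^sub>v Matrix.vec m (\<lambda>k. X (k + n 1) z) = phi_vec2 r \<omega> n z" for z
  proof (rule eq_vecI)
    fix i assume "i < dim_vec (phi_vec2 r \<omega> n z)"
    then have i: "i < m" by (simp add: phi2)
    then have "poly (\<phi> (i + n 1)) z = (\<Sum>k<N. G (i + n 1) k * X k z)"
      by (intro expand) (simp add: m_def)
    also have "\<dots> = (\<Sum>k<m. G (i + n 1) (k + n 1) * X (k + n 1) z)"
      using sum_lessThan_split[OF n1, of "\<lambda>k. G (i + n 1) k * X k z"]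
      by (simp add: G_first[unfolded One_nat_def] m_def)
    finally show "(moment_mat22 r \<omega> n *\<^sub>v Matrix.vec m (\<lambda>k. X (k + n 1) z)) $ i = phi_vec2 r \<omega> n z $ i"
      using i by (simp add: phi2 M22 scalar_prod_def atLeast0LessThan)
  qed (simp add: phi2 M22)
  have indep: "\<forall>v\<in>carrier_vec m. (\<forall>z. scalar_prod v (phi_vec2 r \<omega> n z) = 0) \<longrightarrow> v = 0\<^sub>v m"
  proof (intro ballI impI)
    fix v assume v: "v \<in> carrier_vec m" and orth: "\<forall>z. scalar_prod v (phi_vec2 r \<omega> n z) = 0"
    \<comment> \<open>Padding \<open>v\<close> with zeros turns the relation into one among all
      \<phi>_j with \<open>j < N\<close>, to which independence of a monic basis applies.\<close>
    define a where "a j = (if j < n 1 then 0 else v $ (j - n 1))" for j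
    have "poly (\<Sum>j<N. Polynomial.smult (a j) (\<phi> j)) z = 0" for z
      using orth[THEN spec, of z] sum_lessThan_split[OF n1, of "\<lambda>j. a j * poly (\<phi> j) z"]
      by (simp add: poly_sum a_def phi2 scalar_prod_def atLeast0LessThan m_def)
    then have "(\<Sum>j<N. Polynomial.smult (a j) (\<phi> j)) = 0"
      using poly_all_0_iff_0 by blast
    then have "a j = 0" if "j < N" for j
      using that by (intro monic_basis_independent[of N \<phi> a] sys(1,2))
    then have "v $ i = 0" if "i < m" for i
      using that by (metis a_def add_diff_cancel_right' less_diff_conv m_def not_add_less2)
    with v show "v = 0\<^sub>v m"
      by (intro eq_vecI) auto
  qed
  have carrier: "moment_mat22 r \<omega> n \<in> carrier_mat m m"
    by (simp add: M22)
  note inverse = mat_inverse_solve[where y = "\<lambda>z. Matrix.vec m (\<lambda>k. X (k + n 1) z)"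
      and u = "phi_vec2 r \<omega> n", OF carrier vec_carrier solve indep]

  have K0: "CD_kernel0 (\<omega> 1) N z \<xi> = (\<Sum>j<N. D j \<xi> * poly (\<phi> j) z)" for z \<xi>
    unfolding CD_kernel0_def D_def \<phi>_def h_def by (intro sum.cong refl) simp
  have pi: "conjugate (pi_vec r \<omega> n \<xi>) $ k = cnj (\<psi> (k + n 1) \<xi>) - (\<Sum>j<N. D j \<xi> * G j (k + n 1))"
    if k: "k < m" for k \<xi>
  proof -
    let ?w = "\<omega> (l (k + n 1))" and ?q = "\<phi> (b (k + n 1))"
    have w: "weight ?w"
      using k by (intro wt) (simp add: m_def)
    have "(\<integral>s. cnj (CD_kernel0 (\<omega> 1) N s \<xi>) * \<psi> (k + n 1) s \<partial>arclength) =
        (\<integral>s. (\<Sum>j<N. cnj (D j \<xi>) * (poly ?q s * cnj (poly (\<phi> j) s) * complex_of_real (?w s))) \<partial>arclength)"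
      unfolding K0 \<psi>_def cnj_sum sum_distrib_right
      by (intro Bochner_Integration.integral_cong sum.cong refl) (simp add: mult_ac)
    also have "\<dots> = (\<Sum>j<N. cnj (D j \<xi>) * inner_wt ?w ?q (\<phi> j))"
      using integrable_inner_wt[OF w] by (simp add: inner_wt_def)
    \<comment> \<open>The integral pairs the polynomials in the order opposite to \<open>G\<close>;
      Hermitian symmetry restores it.\<close>
    also have "\<dots> = cnj (\<Sum>j<N. D j \<xi> * G j (k + n 1))"
      unfolding cnj_sum G_def complex_cnj_mult by (intro sum.cong refl arg_cong2[where f = times] inner_wt_cnj)
    finally show ?thesis
      unfolding pi_vec_def psi2 N_def[symmetric] m_def[symmetric] using k by simp
  qed

  have "CD_kernel r \<omega> n z \<xi> - CD_kernel0 (\<omega> 1) N z \<xi> =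
      scalar_prod (conjugate (pi_vec r \<omega> n \<xi>))
        (the (mat_inverse (moment_mat22 r \<omega> n)) *\<^sub>v phi_vec2 r \<omega> n z)" for z \<xi>
  proof -
    \<comment> \<open>\<open>S k\<close> is the integral of K_0(s, \<xi>) against the conjugate of
      \<psi>_k(s), so \<open>cnj (\<psi> k \<xi>) - S k\<close> extends the entries of the conjugate
      of \<pi>(\<xi>) to all positions \<open>k < N\<close>.\<close>
    define S where "S k = (\<Sum>j<N. D j \<xi> * G j k)" for k
    have "CD_kernel0 (\<omega> 1) N z \<xi> = (\<Sum>j<N. \<Sum>k<N. D j \<xi> * G j k * X k z)"
      unfolding K0 by (intro sum.cong refl) (simp add: expand sum_distrib_left mult.assoc)
    also have "\<dots> = (\<Sum>k<N. S k * X k z)"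
      unfolding S_def sum_distrib_right by (rule sum.swap)
    finally have "CD_kernel r \<omega> n z \<xi> - CD_kernel0 (\<omega> 1) N z \<xi> = (\<Sum>k<N. (cnj (\<psi> k \<xi>) - S k) * X k z)"
      by (simp add: kernel left_diff_distrib sum_subtractf)
    also have "\<dots> = (\<Sum>k<n 1. (cnj (\<psi> k \<xi>) - S k) * X k z) +
        (\<Sum>k<m. (cnj (\<psi> (k + n 1) \<xi>) - S (k + n 1)) * X (k + n 1) z)"
      unfolding m_def by (rule sum_lessThan_split[OF n1])
    \<comment> \<open>K_0 reproduces the first block: only \<open>j = k\<close> survives in
      \<open>S k\<close>, and its norm \<open>h k\<close> cancels the denominator of
      \<open>D k \<xi>\<close>.\<close>
    also have "(\<Sum>k<n 1. (cnj (\<psi> k \<xi>) - S k) * X k z) = 0"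
    proof (rule sum.neutral, rule ballI)
      fix k assume "k \<in> {..<n 1}"
      then have k: "k < n 1" "k < N" using n1 by auto
      have "S k = (\<Sum>j<N. if j = k then D k \<xi> * complex_of_real (h k) else 0)"
        unfolding S_def using k by (intro sum.cong refl) (simp only: G_first if_distrib mult_zero_right cong: if_cong, simp)
      also have "\<dots> = cnj (\<psi> k \<xi>)"
        using k sys(3)[of k] by (simp add: D_def \<psi>_def first)
      finally show "(cnj (\<psi> k \<xi>) - S k) * X k z = 0" by simp
    qed
    also have "0 + (\<Sum>k<m. (cnj (\<psi> (k + n 1) \<xi>) - S (k + n 1)) * X (k + n 1) z) =
        scalar_prod (conjugate (pi_vec r \<omega> n \<xi>)) (Matrix.vec m (\<lambda>k. X (k + n 1) z))"
      unfolding scalar_prod_def dim_vec atLeast0LessThan add_0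
      by (intro sum.cong refl) (simp only: pi S_def lessThan_iff index_vec)
    finally show ?thesis
      unfolding inverse(2) .
  qed
  with inverse(1) show ?thesis
    unfolding N_def by blast
qed

end
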